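(* Consider the stationary iterates $(x_k)_{k\in\mathbb{Z}}$ of stochastic gradient descent with momentum (SGDM) with stepsize $\gamma>0$ and momentum $\alpha\in[0,1)$ under the zero-th order noise model, with sampling with replacement (defined in the context). For $\lambda>0$ let $$\rho_\pm=\frac{2(1-\alpha)^2+\gamma^2\lambda^2-2(1+\alpha)\gamma\lambda\pm 2(1-\alpha)\sqrt{(1-\alpha)^2+\gamma^2\lambda^2-2(1+\alpha)\gamma\lambda}}{\gamma^2\lambda^2}.$$ When $\gamma\lambda_i\ll 1-\alpha$ for all $i\in\{1,\dots,d\}$, we have, for each $\lambda=\lambda_i$, $$\rho_+=\frac{4(1-\alpha)^2}{\gamma^2\lambda^2}+O\left(\frac{1}{\gamma\lambda}\right),\qquad \rho_-=\left(\frac{1+\alpha}{1-\alpha}\right)^2+O(\gamma\lambda),$$ and $$\mathrm{Tr}[\mathrm{Var}(x_k)]=\sum_{i=1}^d\left(\frac{\gamma\,(u_i^\top\Sigma u_i)}{2(1-\alpha)\lambda_i}+O\left(\sqrt{\frac{\gamma^3}{\lambda_i}}\right)\right).$$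
   Context: Let $A_1,\dots,A_n\in\mathbb{R}^{d\times d}$ be symmetric and $b_1,\dots,b_n\in\mathbb{R}^d$; put $A=\frac1n\sum_i A_i$, assumed strictly positive definite, $b=\frac1n\sum_i b_i$, $x^\star=-A^{-1}b$, $y_i=-A_iA^{-1}b+b_i$ (so $\sum_i y_i=0$), $\Sigma=\frac1n\sum_{i=1}^n y_iy_i^\top$. Let $(u_i)_{i=1}^d$ be an orthonormal basis of eigenvectors of $A$, $Au_i=\lambda_iu_i$, $\lambda_i>0$. Zero-th order noise model: the gradient of $f_i(x)=\frac12x^\top A_ix+b_i^\top x$ is replaced by $\widehat{\nabla f_i}(x)=Ax+y_i+b$. SGDM: $x_{k+1}=x_k+\alpha(x_k-x_{k-1})-\gamma\widehat{\nabla f_{i_k}}(x_k)$; equivalently, with $\Delta x_k=x_k-x^\star$, $\Delta x_{k+1}=((1+\alpha)\mathrm{Id}-\gamma A)\Delta x_k-\alpha\Delta x_{k-1}-\gamma y_{i_k}$. Sampling with replacement: $(i_k)_{k\in\mathbb{Z}}$ i.i.d. uniform on $\{1,\dots,n\}$. Stationary iterates: $(\Delta x_k)_k$ is the output of the linear time-invariant system with input $(y_{i_k})_k$ defined by this recursion, i.e. $\Delta x_k=\sum_{j\in\mathbb{Z}}H_{k-j}y_{i_j}$, where $(H_k)_{k\in\mathbb{Z}}$ are the matrices with $\sum_kH_kz^{-k}=H(z):=-\gamma z(z^2\mathrm{Id}-z((1+\alpha)\mathrm{Id}-\gamma A)+\alpha\mathrm{Id})^{-1}$ for $|z|=1$.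 *)

theory Defs
  imports "HOL-Probability.Probability"
begin

definition average :: "nat \<Rightarrow> (nat \<Rightarrow> 'a::real_vector) \<Rightarrow> 'a" where
  "average n f = (1 / real n) *\<^sub>R (\<Sum>i\<in>{1..n}. f i)"

definition pos_definite :: "real^'d^'d \<Rightarrow> bool" where
  "pos_definite A \<longleftrightarrow> transpose A = A \<and> (\<forall>v. v \<noteq> 0 \<longrightarrow> 0 < v \<bullet> (A *v v))"

text \<open>The family is indexed by the dimension type, so orthonormality already makes it a basis.\<close>
definition orthonormal_eigenbasis ::
    "real^'d^'d \<Rightarrow> ('d \<Rightarrow> real^'d) \<Rightarrow> ('d \<Rightarrow> real) \<Rightarrow> bool" where
  "orthonormal_eigenbasis A u lam \<longleftrightarrow>
     (\<forall>i j. u i \<bullet> u j = (if i = j then 1 else 0)) \<and> (\<forall>i. A *v u i = lam i *\<^sub>R u i)"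

definition minimizer :: "nat \<Rightarrow> (nat \<Rightarrow> real^'d^'d) \<Rightarrow> (nat \<Rightarrow> real^'d) \<Rightarrow> real^'d" where
  "minimizer n A b = - (matrix_inv (average n A) *v average n b)"

definition grad_noise ::
    "nat \<Rightarrow> (nat \<Rightarrow> real^'d^'d) \<Rightarrow> (nat \<Rightarrow> real^'d) \<Rightarrow> nat \<Rightarrow> real^'d" where
  "grad_noise n A b i = - (A i *v (matrix_inv (average n A) *v average n b)) + b i"

definition outer_square :: "real^'d \<Rightarrow> real^'d^'d" where
  "outer_square v = (\<chi> r s. v $ r * v $ s)"

definition noise_cov ::
    "nat \<Rightarrow> (nat \<Rightarrow> real^'d^'d) \<Rightarrow> (nat \<Rightarrow> real^'d) \<Rightarrow> real^'d^'d" where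
  "noise_cov n A b = average n (\<lambda>i. outer_square (grad_noise n A b i))"

definition iid_uniform_indices :: "nat \<Rightarrow> 'w measure \<Rightarrow> (int \<Rightarrow> 'w \<Rightarrow> nat) \<Rightarrow> bool" where
  "iid_uniform_indices n M I \<longleftrightarrow> prob_space M \<and>
     prob_space.indep_vars M (\<lambda>_. count_space {1..n}) I UNIV \<and>
     (\<forall>k. distr M (count_space {1..n}) (I k) = uniform_count_measure {1..n})"

definition complex_matrix :: "real^'d^'d \<Rightarrow> complex^'d^'d" where
  "complex_matrix A = map_matrix complex_of_real A"

text \<open>The \<open>z\<close>-transform \<open>H(z) = -\<gamma> z (z\<^sup>2 Id - z ((1 + \<alpha>) Id - \<gamma> A) + \<alpha> Id)\<^sup>-\<^sup>1\<close>
  of the recursion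
  \<open>\<Delta>x (k + 1) = ((1 + \<alpha>) Id - \<gamma> A) \<Delta>x k - \<alpha> \<Delta>x (k - 1) - \<gamma> y (i k)\<close>;
  \<open>mat c\<close> is the scalar matrix \<open>c Id\<close>.\<close>
definition sgdm_transfer :: "real \<Rightarrow> real \<Rightarrow> real^'d^'d \<Rightarrow> complex \<Rightarrow> complex^'d^'d" where
  "sgdm_transfer \<gamma> \<alpha> A z =
     mat (- complex_of_real \<gamma> * z) **
     matrix_inv (mat (z^2) - mat z ** complex_matrix (mat (1 + \<alpha>) - \<gamma> *\<^sub>R A)
                 + mat (complex_of_real \<alpha>))"

text \<open>The coefficients are real because \<open>H(cnj z)\<close> is the entrywise conjugate of \<open>H(z)\<close>.\<close>
definition sgdm_impulse_response :: "real \<Rightarrow> real \<Rightarrow> real^'d^'d \<Rightarrow> int \<Rightarrow> real^'d^'d" where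
  "sgdm_impulse_response \<gamma> \<alpha> A = (THE H. \<forall>z. cmod z = 1 \<longrightarrow>
     ((\<lambda>k. mat (z powi (- k)) ** complex_matrix (H k)) has_sum sgdm_transfer \<gamma> \<alpha> A z) UNIV)"

definition sgdm_iterate ::
    "real \<Rightarrow> real \<Rightarrow> nat \<Rightarrow> (nat \<Rightarrow> real^'d^'d) \<Rightarrow> (nat \<Rightarrow> real^'d) \<Rightarrow>
     (int \<Rightarrow> 'w \<Rightarrow> nat) \<Rightarrow> int \<Rightarrow> 'w \<Rightarrow> real^'d" where
  "sgdm_iterate \<gamma> \<alpha> n A b I k \<omega> = minimizer n A b +
     (\<Sum>\<^sub>\<infinity>j. sgdm_impulse_response \<gamma> \<alpha> (average n A) (k - j) *v grad_noise n A b (I j \<omega>))"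

definition var_matrix :: "'w measure \<Rightarrow> ('w \<Rightarrow> real^'d) \<Rightarrow> real^'d^'d" where
  "var_matrix M X =
     integral\<^sup>L M (\<lambda>\<omega>. outer_square (X \<omega> - integral\<^sup>L M X))"

text \<open>For fixed \<open>\<alpha> \<in> [0, 1)\<close> the radicand is positive once \<open>\<gamma> l\<close> is small; for
  larger \<open>\<gamma> l\<close> it can be negative, and then the real \<open>sqrt\<close> is not the complex root.\<close>
definition rho_plus :: "real \<Rightarrow> real \<Rightarrow> real \<Rightarrow> real" where
  "rho_plus \<gamma> \<alpha> l =
     (2 * (1 - \<alpha>)^2 + \<gamma>^2 * l^2 - 2 * (1 + \<alpha>) * \<gamma> * l
      + 2 * (1 - \<alpha>) * sqrt ((1 - \<alpha>)^2 + \<gamma>^2 * l^2 - 2 * (1 + \<alpha>) * \<gamma> * l)) / (\<gamma>^2 * l^2)"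

definition rho_minus :: "real \<Rightarrow> real \<Rightarrow> real \<Rightarrow> real" where
  "rho_minus \<gamma> \<alpha> l =
     (2 * (1 - \<alpha>)^2 + \<gamma>^2 * l^2 - 2 * (1 + \<alpha>) * \<gamma> * l
      - 2 * (1 - \<alpha>) * sqrt ((1 - \<alpha>)^2 + \<gamma>^2 * l^2 - 2 * (1 + \<alpha>) * \<gamma> * l)) / (\<gamma>^2 * l^2)"

end

theory Submission
  imports Defs
begin

text \<open>In an eigenbasis \<open>u\<close> of \<open>A\<close> the recursion decouples into scalar recursions with
  characteristic polynomial \<open>z\<^sup>2 - (1 + \<alpha> - \<gamma> \<lambda>) z + \<alpha>\<close>. Once \<open>\<gamma> \<lambda> \<le> (1 - \<alpha>)\<^sup>2 / 8\<close> its roots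
  \<open>r \<noteq> s\<close> are real and lie in the unit disc, so that the impulse response is
  \<open>-\<gamma> (r\<^sup>m - s\<^sup>m) / (r - s)\<close>, and absolutely summable coefficients are determined by their sum on the
  unit circle. The noise is centred and uncorrelated in time, hence the variance of a mode is
  \<open>u\<^sup>T \<Sigma> u\<close> times the energy of the impulse response,
  \<open>\<gamma> (1 + \<alpha>) / ((1 - \<alpha>) \<lambda> (2 (1 + \<alpha>) - \<gamma> \<lambda>))
    = \<gamma> / (2 (1 - \<alpha>) \<lambda>) + \<gamma>\<^sup>2 / (2 (1 - \<alpha>) (2 (1 + \<alpha>) - \<gamma> \<lambda>))\<close>,
  and \<open>\<gamma>\<^sup>2 \<le> sqrt (\<gamma>\<^sup>3 / \<lambda>)\<close> because \<open>\<gamma> \<lambda> \<le> 1\<close>. The estimates for \<open>\<rho>\<^sub>\<plusminus>\<close> rest on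
  \<open>\<rho>\<^sub>\<plusminus> = ((1 - \<alpha> \<plusminus> d) / (\<gamma> \<lambda>))\<^sup>2\<close>, where \<open>d\<close> is the square root in their definition.\<close>

subsection \<open>Uniqueness of Laurent series on the unit circle\<close>

lemma has_sum_vec_iff:
  fixes f :: "'k \<Rightarrow> 'a::real_normed_vector ^ 'n"
  shows "(f has_sum s) A \<longleftrightarrow> (\<forall>i. ((\<lambda>k. f k $ i) has_sum s $ i) A)"
proof
  assume "(f has_sum s) A"
  then show "\<forall>i. ((\<lambda>k. f k $ i) has_sum s $ i) A"
    by (auto intro: has_sum_bounded_linear bounded_linear_vec_nth)
next
  assume "\<forall>i. ((\<lambda>k. f k $ i) has_sum s $ i) A"
  then show "(f has_sum s) A"
    unfolding has_sum_def by (intro vec_tendstoI) simp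
qed

lemma has_sum_sum:
  fixes f :: "'i \<Rightarrow> 'k \<Rightarrow> 'a::topological_comm_monoid_add"
  assumes "\<And>i. i \<in> I \<Longrightarrow> (f i has_sum s i) A"
  shows "((\<lambda>k. \<Sum>i\<in>I. f i k) has_sum (\<Sum>i\<in>I. s i)) A"
  using assms by (induction I rule: infinite_finite_induct) (auto intro: has_sum_add)

lemma has_sum_diff:
  fixes f g :: "'k \<Rightarrow> 'a::topological_ab_group_add"
  assumes "(f has_sum a) A" and "(g has_sum b) A"
  shows "((\<lambda>k. f k - g k) has_sum (a - b)) A"
  using has_sum_add[OF assms(1), of "\<lambda>k. - g k" "- b"] assms(2) by (simp add: has_sum_uminus)

text \<open>For \<open>0 < \<bar>d\<bar> < N\<close> the ratio \<open>w\<close>, the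
  \<open>d\<close>-th power of a primitive \<open>N\<close>-th root of unity, satisfies
  \<open>w \<noteq> 1\<close> and \<open>w ^ N = 1\<close>, so the geometric sum over
  \<open>j\<close> vanishes.\<close>

lemma root_of_unity_average:
  fixes d :: int
  assumes "0 < N" and "\<bar>d\<bar> < int N"
  shows "(\<Sum>j<N. (cis (2 * pi / N) ^ j) powi d) = (if d = 0 then of_nat N else 0)"
proof (cases "d = 0")
  case False
  define w where "w = cis (2 * pi / N) powi d"
  have "cis (2 * pi / N) ^ m \<noteq> 1" if "0 < m" "m < N" for m
  proof
    assume "cis (2 * pi / N) ^ m = 1"
    then have "exp (2 * of_real pi * \<i> * of_nat m / of_nat N) = 1"
      by (simp add: cis_conv_exp mult_ac flip: exp_of_nat_mult)
    with complex_root_unity_eq_1[of N m] that assms show False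
      by (auto dest: dvd_imp_le)
  qed
  from this[of "nat \<bar>d\<bar>"] have "cis (2 * pi / N) ^ nat \<bar>d\<bar> \<noteq> 1"
    using False assms by linarith
  then have "w \<noteq> 1"
    unfolding w_def power_int_def by (simp add: power_inverse abs_if not_le del: cis_inverse split: if_splits)
  moreover have "w ^ N = 1"
  proof -
    have "w ^ N = cis (2 * pi * of_int d)"
      using assms(1) by (simp add: w_def cis_power_int Complex.DeMoivre mult_ac)
    then show ?thesis by (simp add: cis_multiple_2pi)
  qed
  ultimately have "(\<Sum>j<N. w ^ j) = 0"
    by (simp add: geometric_sum)
  moreover have "(cis (2 * pi / N) ^ j) powi d = w ^ j" for j
    by (simp add: w_def cis_power_int Complex.DeMoivre mult_ac)
  ultimately show ?thesis using False by simp
qed simp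

text \<open>Averaging \<open>z\<^sup>m\<close> times the series over the \<open>N\<close>-th roots of unity leaves \<open>c m\<close> plus
  coefficients whose index is at distance at least \<open>N\<close> from \<open>m\<close>.\<close>
lemma Laurent_series_circle_unique:
  fixes c :: "int \<Rightarrow> complex"
  assumes 0: "\<And>z. cmod z = 1 \<Longrightarrow> ((\<lambda>k. z powi (- k) * c k) has_sum 0) UNIV"
  shows "c m = 0"
proof -
  \<comment> \<open>At \<open>z = 1\<close> the hypothesis is a statement about \<open>c\<close>
    itself, and unconditional summability in the complex numbers is absolute. This gives the tail
    bound used below.\<close>
  have "c summable_on UNIV"
    using 0[of 1] by (auto simp: summable_on_def)
  then obtain S where S: "((\<lambda>k. cmod (c k)) has_sum S) UNIV"
    by (auto simp: summable_on_iff_abs_summable_on_complex summable_on_def)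
  have "cmod (c m) \<le> \<epsilon>" if "\<epsilon> > 0" for \<epsilon>
  proof -
    obtain F0 where F0: "finite F0" "dist (\<Sum>k\<in>F0. cmod (c k)) S \<le> \<epsilon>"
      using has_sum_finite_approximation[OF S \<open>\<epsilon> > 0\<close>] by auto
    \<comment> \<open>Adding \<open>m\<close> only shrinks the tail, since the terms are
      nonnegative, and guarantees that the coefficient to be isolated is among those kept.\<close>
    define F where "F = insert m F0"
    have F: "finite F" "m \<in> F" "S - (\<Sum>k\<in>F. cmod (c k)) \<le> \<epsilon>"
    proof -
      have "(\<Sum>k\<in>F0. cmod (c k)) \<le> (\<Sum>k\<in>F. cmod (c k))"
        using F0(1) by (intro sum_mono2) (auto simp: F_def)
      with F0 show "S - (\<Sum>k\<in>F. cmod (c k)) \<le> \<epsilon>" by (auto simp: dist_real_def)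
    qed (use F0 in \<open>auto simp: F_def\<close>)
    \<comment> \<open>With \<open>N\<close> beyond every distance from \<open>m\<close> to
      \<open>F\<close>, no index of \<open>F\<close> other than \<open>m\<close> survives the
      averaging; all aliases fall into the small tail.\<close>
    obtain N :: nat where N: "0 < N" "\<And>k. k \<in> F \<Longrightarrow> \<bar>m - k\<bar> < int N"
    proof
      show "0 < Suc (Max ((\<lambda>k. nat \<bar>m - k\<bar>) ` F))" by simp
      show "\<bar>m - k\<bar> < int (Suc (Max ((\<lambda>k. nat \<bar>m - k\<bar>) ` F)))" if "k \<in> F" for k
      proof -
        have "nat \<bar>m - k\<bar> \<le> Max ((\<lambda>k. nat \<bar>m - k\<bar>) ` F)"
          using that F(1) by (intro Max_ge) auto
        then show ?thesis by linarith
      qed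
    qed
    define \<zeta> where "\<zeta> = cis (2 * pi / N)"
    have \<zeta>: "cmod (\<zeta> ^ j) = 1" for j by (simp add: \<zeta>_def norm_power)
    then have nz: "\<zeta> ^ j \<noteq> 0" for j by (metis norm_zero zero_neq_one)
    define f where "f k = (1 / of_nat N) * (\<Sum>j<N. (\<zeta> ^ j) powi (m - k)) * c k" for k
    have "((\<lambda>k. (1 / of_nat N) * (\<Sum>j<N. (\<zeta> ^ j) powi m * ((\<zeta> ^ j) powi (-k) * c k))) has_sum
        (1 / of_nat N) * (\<Sum>j<N. (\<zeta> ^ j) powi m * 0)) UNIV"
      by (intro has_sum_cmult_right has_sum_sum 0 \<zeta>)
    also have "(\<lambda>k. (1 / of_nat N) * (\<Sum>j<N. (\<zeta> ^ j) powi m * ((\<zeta> ^ j) powi (-k) * c k))) = f"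
    proof
      fix k
      have "(\<zeta> ^ j) powi (m - k) = (\<zeta> ^ j) powi m * (\<zeta> ^ j) powi (- k)" for j
        using power_int_add[of "\<zeta> ^ j" m "- k"] nz by simp
      then show "(1 / of_nat N) * (\<Sum>j<N. (\<zeta> ^ j) powi m * ((\<zeta> ^ j) powi (-k) * c k)) = f k"
        by (simp only: f_def sum_distrib_right mult.assoc)
    qed
    finally have "(f has_sum 0) UNIV" by simp
    \<comment> \<open>The full averaged series sums to 0 and its part over \<open>F\<close> is
      \<open>c m\<close>, so the tail sums to \<open>- c m\<close>; its norm is at most the tail of
      \<open>cmod (c k)\<close>.\<close>
    then have "(f has_sum (0 - sum f F)) (UNIV - F)"
      by (intro has_sum_Diff) (auto simp: F)
    moreover have "sum f F = c m"
    proof -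
      have "f k = (if k = m then c m else 0)" if "k \<in> F" for k
        using root_of_unity_average[OF N(1) N(2)[OF that]] N(1) by (auto simp: f_def \<zeta>_def)
      then have "sum f F = (\<Sum>k\<in>F. if k = m then c m else 0)" by simp
      then show ?thesis using F by simp
    qed
    moreover have "((\<lambda>k. cmod (c k)) has_sum (S - (\<Sum>k\<in>F. cmod (c k)))) (UNIV - F)"
      by (intro has_sum_Diff S) (auto simp: F)
    moreover have "cmod (f k) \<le> cmod (c k)" for k
    proof -
      have "cmod (\<Sum>j<N. (\<zeta> ^ j) powi (m - k)) \<le> (\<Sum>j<N. 1)"
        by (intro sum_norm_le) (simp add: norm_power_int \<zeta>)
      then have "cmod (\<Sum>j<N. (\<zeta> ^ j) powi (m - k)) / N * cmod (c k) \<le> 1 * cmod (c k)"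
        using N(1) by (intro mult_right_mono) (auto simp: field_simps)
      then show ?thesis by (simp add: f_def norm_mult norm_divide)
    qed
    ultimately have "cmod (0 - c m) \<le> S - (\<Sum>k\<in>F. cmod (c k))"
      by (metis norm_infsum_le)
    with F(3) show ?thesis by simp
  qed
  then show ?thesis
    using field_le_epsilon[of "cmod (c m)" 0] by simp
qed

subsection \<open>Matrices diagonal in an orthonormal basis\<close>

text \<open>This is the sum of \<open>f i\<close> times the projection onto \<open>u i\<close>, that
  is, a function of any matrix with eigenbasis \<open>u\<close>. The values lie in a general normed
  field so that the real matrix \<open>A\<close> and the complex transfer function share the same
  calculus.\<close>

definition spectral_matrix :: "('d \<Rightarrow> real^'d) \<Rightarrow> ('d \<Rightarrow> 'a::real_normed_field) \<Rightarrow> 'a^'d^'d" where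
  "spectral_matrix u f = (\<chi> p q. \<Sum>i\<in>UNIV. f i * of_real (u i $ p * u i $ q))"

definition orthonormal_family :: "('d::finite \<Rightarrow> real^'d) \<Rightarrow> bool" where
  "orthonormal_family u \<longleftrightarrow> (\<forall>i j. u i \<bullet> u j = (if i = j then 1 else 0))"

text \<open>The index type is the dimension type, so the matrix \<open>U\<close> with columns
  \<open>u i\<close> is square and its left inverse \<open>transpose U\<close> is also a right
  inverse.\<close>

lemma orthonormal_completeness:
  assumes "orthonormal_family u"
  shows "(\<Sum>i\<in>UNIV. u i $ p * u i $ q) = (if p = q then 1 else 0)"
proof -
  define U where "U = (\<chi> p i. u i $ p)"
  have "transpose U ** U = mat 1"
    using assms by (simp add: orthonormal_family_def U_def transpose_def matrix_matrix_mult_def mat_def inner_vec_def vec_eq_iff)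
  then have "U ** transpose U = mat 1"
    using matrix_left_right_inverse by blast
  then have "(U ** transpose U) $ p $ q = mat 1 $ p $ q" by simp
  then show ?thesis
    by (simp add: U_def transpose_def matrix_matrix_mult_def mat_def)
qed

lemma orthonormal_expansion:
  assumes "orthonormal_family u"
  shows "(\<Sum>i\<in>UNIV. (u i \<bullet> v) *\<^sub>R u i) = v"
proof -
  have "(\<Sum>i\<in>UNIV. (u i \<bullet> v) *\<^sub>R u i) $ p = v $ p" for p
  proof -
    have "(\<Sum>i\<in>UNIV. (u i \<bullet> v) *\<^sub>R u i) $ p = (\<Sum>i\<in>UNIV. \<Sum>q\<in>UNIV. v $ q * (u i $ q * u i $ p))"
      by (simp add: inner_vec_def sum_distrib_right sum_distrib_left mult_ac)
    also have "\<dots> = (\<Sum>q\<in>UNIV. v $ q * (\<Sum>i\<in>UNIV. u i $ q * u i $ p))"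
      by (subst sum.swap) (simp add: sum_distrib_left)
    also have "\<dots> = v $ p"
      by (simp add: orthonormal_completeness[OF assms] if_distrib cong: if_cong)
    finally show ?thesis .
  qed
  then show ?thesis by (simp add: vec_eq_iff)
qed

lemma orthonormal_parseval:
  assumes "orthonormal_family u"
  shows "v \<bullet> v = (\<Sum>i\<in>UNIV. (u i \<bullet> v)\<^sup>2)"
proof -
  have "v \<bullet> v = (\<Sum>i\<in>UNIV. (u i \<bullet> v) *\<^sub>R u i) \<bullet> v"
    by (simp add: orthonormal_expansion[OF assms])
  then show ?thesis by (simp add: inner_sum_left power2_eq_square)
qed

lemma spectral_matrix_one:
  assumes "orthonormal_family u"
  shows "spectral_matrix u (\<lambda>_. c) = mat c"
proof -
  have "spectral_matrix u (\<lambda>_. c) $ p $ q = mat c $ p $ q" for p q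
  proof -
    have "spectral_matrix u (\<lambda>_. c) $ p $ q = c * of_real (\<Sum>i\<in>UNIV. u i $ p * u i $ q)"
      by (simp add: spectral_matrix_def sum_distrib_left)
    then show ?thesis by (simp add: orthonormal_completeness[OF assms] mat_def)
  qed
  then show ?thesis by (simp add: vec_eq_iff)
qed

text \<open>Orthonormality removes the cross terms. Products, and with them inverses, are thereby
  computed one eigenvalue at a time.\<close>

lemma spectral_matrix_mult:
  assumes "orthonormal_family u"
  shows "spectral_matrix u f ** spectral_matrix u g = spectral_matrix u (\<lambda>i. f i * g i)"
proof -
  have "(spectral_matrix u f ** spectral_matrix u g) $ p $ t = spectral_matrix u (\<lambda>i. f i * g i) $ p $ t" for p t
  proof -
    have "(spectral_matrix u f ** spectral_matrix u g) $ p $ t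
        = (\<Sum>q\<in>UNIV. \<Sum>i\<in>UNIV. \<Sum>j\<in>UNIV. f i * g j * of_real (u i $ p * u j $ t) * of_real (u i $ q * u j $ q))"
      by (simp add: spectral_matrix_def matrix_matrix_mult_def sum_product mult_ac)
    also have "\<dots> = (\<Sum>i\<in>UNIV. \<Sum>j\<in>UNIV. \<Sum>q\<in>UNIV. f i * g j * of_real (u i $ p * u j $ t) * of_real (u i $ q * u j $ q))"
      by (rule trans[OF sum.swap]) (intro sum.cong refl sum.swap)
    also have "\<dots> = (\<Sum>i\<in>UNIV. \<Sum>j\<in>UNIV. f i * g j * of_real (u i $ p * u j $ t) * of_real (u i \<bullet> u j))"
      by (simp add: inner_vec_def sum_distrib_left)
    also have "\<dots> = (\<Sum>i\<in>UNIV. \<Sum>j\<in>UNIV. if i = j then f i * g j * of_real (u i $ p * u j $ t) else 0)"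
      using assms by (intro sum.cong refl) (simp add: orthonormal_family_def)
    finally show ?thesis by (simp add: spectral_matrix_def)
  qed
  then show ?thesis by (simp add: vec_eq_iff)
qed

lemma spectral_matrix_vector_mult:
  fixes f :: "'d::finite \<Rightarrow> real"
  shows "spectral_matrix u f *v y = (\<Sum>i\<in>UNIV. (f i * (u i \<bullet> y)) *\<^sub>R u i)"
proof -
  have "(spectral_matrix u f *v y) $ p = (\<Sum>i\<in>UNIV. (f i * (u i \<bullet> y)) *\<^sub>R u i) $ p" for p
    by (simp add: spectral_matrix_def matrix_vector_mult_def inner_vec_def sum_distrib_left sum_distrib_right mult_ac)
      (rule sum.swap)
  then show ?thesis by (simp add: vec_eq_iff)
qed

lemma spectral_decomposition:
  assumes "orthonormal_family u" and "\<And>i. A *v u i = lam i *\<^sub>R u i"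
  shows "A = spectral_matrix u lam"
proof -
  have "A *v v = spectral_matrix u lam *v v" for v
  proof -
    have "A *v v = A *v (\<Sum>i\<in>UNIV. (u i \<bullet> v) *\<^sub>R u i)"
      by (simp add: orthonormal_expansion[OF assms(1)])
    also have "\<dots> = (\<Sum>i\<in>UNIV. (u i \<bullet> v) *\<^sub>R (A *v u i))"
      by (simp add: vec.sum matrix_vector_mult_scaleR)
    finally show ?thesis
      by (simp add: assms(2) spectral_matrix_vector_mult mult_ac)
  qed
  then show ?thesis by (simp add: matrix_eq)
qed

lemma spectral_matrix_add: "spectral_matrix u f + spectral_matrix u g = spectral_matrix u (\<lambda>i. f i + g i)"
  and spectral_matrix_diff: "spectral_matrix u f - spectral_matrix u g = spectral_matrix u (\<lambda>i. f i - g i)"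
  and scaleR_spectral_matrix: "c *\<^sub>R spectral_matrix u f = spectral_matrix u (\<lambda>i. c *\<^sub>R f i)"
  by (auto simp: spectral_matrix_def vec_eq_iff algebra_simps scaleR_sum_right simp flip: sum.distrib sum_subtractf)

lemma complex_spectral_matrix:
  "complex_matrix (spectral_matrix u f) = spectral_matrix u (\<lambda>i. complex_of_real (f i))"
  by (simp add: complex_matrix_def map_matrix_def spectral_matrix_def vec_eq_iff)

lemma has_sum_spectral_matrix:
  assumes "\<And>i. ((\<lambda>k. f k i) has_sum s i) A"
  shows "((\<lambda>k. spectral_matrix u (f k)) has_sum spectral_matrix u s) A"
  unfolding has_sum_vec_iff
  by (auto simp: spectral_matrix_def intro!: has_sum_sum has_sum_cmult_left assms)

text \<open>\<open>matrix_inv\<close> chooses some two-sided inverse; associativity leaves a single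
  candidate.\<close>

lemma matrix_inv_unique:
  fixes P :: "'a::semiring_1 ^ 'n ^ 'n"
  assumes "P ** Q = mat 1" and "Q ** P = mat 1"
  shows "matrix_inv P = Q"
  unfolding matrix_inv_def
proof (rule some_equality)
  show "Q' = Q" if "P ** Q' = mat 1 \<and> Q' ** P = mat 1" for Q'
    using that assms by (metis matrix_mul_assoc matrix_mul_lid matrix_mul_rid)
qed (use assms in simp)

subsection \<open>Transfer function and impulse response\<close>

text \<open>For \<open>r \<noteq> s\<close> this is the Binet form of the solution of
  \<open>x (m + 2) = (r + s) x (m + 1) - r s x m\<close> with \<open>x 0 = 0\<close> and
  \<open>x 1 = -\<gamma>\<close>: the response of one mode to a unit impulse at time 0.\<close>

definition mode_response :: "real \<Rightarrow> real \<Rightarrow> real \<Rightarrow> nat \<Rightarrow> real" where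
  "mode_response \<gamma> r s m = - \<gamma> * (r ^ m - s ^ m) / (r - s)"

definition causal :: "(nat \<Rightarrow> 'a::zero) \<Rightarrow> int \<Rightarrow> 'a" where
  "causal h k = (if k < 0 then 0 else h (nat k))"

lemma has_sum_int_iff_nat:
  fixes f :: "int \<Rightarrow> 'a::{comm_monoid_add, topological_space}"
  assumes "\<And>k. k < 0 \<Longrightarrow> f k = 0"
  shows "(f has_sum S) UNIV \<longleftrightarrow> ((\<lambda>m. f (int m)) has_sum S) UNIV"
proof -
  have "(f has_sum S) UNIV \<longleftrightarrow> (f has_sum S) (range int)"
  proof (rule has_sum_cong_neutral)
    show "f k = 0" if "k \<in> UNIV - range int" for k
      using that assms[of k] by (metis DiffD2 nonneg_int_cases not_le rangeI)
  qed auto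
  then show ?thesis by (simp add: has_sum_reindex comp_def)
qed

lemma has_sum_geometric_nat:
  fixes q :: "'a::{real_normed_field, banach}"
  assumes "norm q < 1"
  shows "((\<lambda>m. q ^ m) has_sum (1 / (1 - q))) UNIV"
  using assms by (intro norm_summable_imp_has_sum geometric_sums) (auto simp: norm_power)

text \<open>Partial fractions split the scalar transfer function into geometric series in
  \<open>r / z\<close> and \<open>s / z\<close>. Both poles lie inside the unit disc, so these
  converge on the circle and only indices \<open>k \<ge> 0\<close> occur.\<close>

lemma mode_transfer:
  assumes z: "cmod z = 1" and "\<bar>r\<bar> < 1" "\<bar>s\<bar> < 1" "r \<noteq> s"
  shows "((\<lambda>k. z powi (- k) * complex_of_real (causal (mode_response \<gamma> r s) k)) has_sum
    (- complex_of_real \<gamma> * z * (1 / (z\<^sup>2 - z * complex_of_real (r + s) + complex_of_real (r * s))))) UNIV"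
proof (subst has_sum_int_iff_nat)
  have z0: "z \<noteq> 0" "z \<noteq> of_real r" "z \<noteq> of_real s"
    using assms by auto
  define c where "c = - complex_of_real \<gamma> / of_real (r - s)"
  have "((\<lambda>m. c * ((of_real r / z) ^ m - (of_real s / z) ^ m)) has_sum
      (c * (1 / (1 - of_real r / z) - 1 / (1 - of_real s / z)))) UNIV"
    using assms by (intro has_sum_cmult_right has_sum_diff has_sum_geometric_nat) (auto simp: norm_divide)
  moreover have "c * (1 / (1 - of_real r / z) - 1 / (1 - of_real s / z)) =
      - complex_of_real \<gamma> * z * (1 / (z\<^sup>2 - z * complex_of_real (r + s) + complex_of_real (r * s)))"
  proof -
    have "1 / (1 - of_real r / z) - 1 / (1 - of_real s / z) = z * of_real (r - s) / ((z - of_real r) * (z - of_real s))"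
      using z0 by (simp add: divide_simps) (simp add: algebra_simps)
    moreover have "z\<^sup>2 - z * complex_of_real (r + s) + complex_of_real (r * s) = (z - of_real r) * (z - of_real s)"
      by (simp add: algebra_simps power2_eq_square)
    ultimately show ?thesis using \<open>r \<noteq> s\<close> by (simp add: c_def)
  qed
  moreover have "c * ((of_real r / z) ^ m - (of_real s / z) ^ m) =
      z powi (- int m) * complex_of_real (causal (mode_response \<gamma> r s) (int m))" for m
    using z0 by (simp add: c_def causal_def mode_response_def power_int_minus power_divide power_inverse divide_inverse algebra_simps)
  ultimately show "((\<lambda>m. z powi (- int m) * complex_of_real (causal (mode_response \<gamma> r s) (int m))) has_sum
      (- complex_of_real \<gamma> * z * (1 / (z\<^sup>2 - z * complex_of_real (r + s) + complex_of_real (r * s))))) UNIV"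
    by simp
qed (simp add: causal_def)

text \<open>Every matrix in the transfer function is a function of \<open>A\<close>, so the
  inversion reduces to dividing by the characteristic polynomial of each mode, which
  \<open>nz\<close> keeps away from 0.\<close>

lemma sgdm_transfer_spectral:
  fixes u :: "'d::finite \<Rightarrow> real^'d"
  assumes u: "orthonormal_family u" and A: "\<And>i. A *v u i = lam i *\<^sub>R u i"
    and nz: "\<And>i. z\<^sup>2 - z * complex_of_real (1 + \<alpha> - \<gamma> * lam i) + complex_of_real \<alpha> \<noteq> 0"
  shows "sgdm_transfer \<gamma> \<alpha> A z = spectral_matrix u
    (\<lambda>i. - complex_of_real \<gamma> * z * (1 / (z\<^sup>2 - z * complex_of_real (1 + \<alpha> - \<gamma> * lam i) + complex_of_real \<alpha>)))"
proof -
  define p where "p i = z\<^sup>2 - z * complex_of_real (1 + \<alpha> - \<gamma> * lam i) + complex_of_real \<alpha>" for i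
  have mat: "mat c = spectral_matrix u (\<lambda>_. c)" for c :: "'a::real_normed_field"
    using spectral_matrix_one[OF u] by metis
  have "complex_matrix (mat (1 + \<alpha>) - \<gamma> *\<^sub>R A) = spectral_matrix u (\<lambda>i. complex_of_real (1 + \<alpha> - \<gamma> * lam i))"
    by (simp add: spectral_decomposition[OF u A] mat scaleR_spectral_matrix spectral_matrix_diff complex_spectral_matrix)
  then have P: "mat (z^2) - mat z ** complex_matrix (mat (1 + \<alpha>) - \<gamma> *\<^sub>R A) + mat (complex_of_real \<alpha>) = spectral_matrix u p"
    by (simp add: mat spectral_matrix_mult[OF u] spectral_matrix_diff spectral_matrix_add p_def[abs_def])
  have "p i \<noteq> 0" for i
    using nz unfolding p_def .
  then have "matrix_inv (spectral_matrix u p) = spectral_matrix u (\<lambda>i. 1 / p i)"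
    by (intro matrix_inv_unique) (simp_all add: spectral_matrix_mult[OF u] mat)
  then show ?thesis
    unfolding sgdm_transfer_def P by (simp add: mat spectral_matrix_mult[OF u] p_def)
qed

lemma mat_mult_component: "(mat c ** M) $ p $ q = c * M $ p $ q"
  by (simp add: matrix_matrix_mult_def mat_def if_distrib[where f="\<lambda>x. x * _"] cong: if_cong)

text \<open>The impulse response is a definite description. Existence comes from
  \<open>mode_transfer\<close> in each mode; uniqueness from
  \<open>Laurent_series_circle_unique\<close> applied entrywise to the difference of two
  candidates.\<close>

lemma sgdm_impulse_response_spectral:
  fixes u :: "'d::finite \<Rightarrow> real^'d"
  assumes u: "orthonormal_family u" and A: "\<And>i. A *v u i = lam i *\<^sub>R u i"
    and roots: "\<And>i. \<bar>r i\<bar> < 1" "\<And>i. \<bar>s i\<bar> < 1" "\<And>i. r i \<noteq> s i"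
    and sum: "\<And>i. r i + s i = 1 + \<alpha> - \<gamma> * lam i" and prod: "\<And>i. r i * s i = \<alpha>"
  shows "sgdm_impulse_response \<gamma> \<alpha> A = (\<lambda>k. spectral_matrix u (\<lambda>i. causal (mode_response \<gamma> (r i) (s i)) k))"
proof -
  define H where "H k = spectral_matrix u (\<lambda>i. causal (mode_response \<gamma> (r i) (s i)) k)" for k
  have H: "((\<lambda>k. mat (z powi (- k)) ** complex_matrix (H k)) has_sum sgdm_transfer \<gamma> \<alpha> A z) UNIV"
    if z: "cmod z = 1" for z
  proof -
    have "z\<^sup>2 - z * complex_of_real (1 + \<alpha> - \<gamma> * lam i) + complex_of_real \<alpha> = (z - of_real (r i)) * (z - of_real (s i))" for i
      by (simp add: algebra_simps power2_eq_square flip: sum prod of_real_mult)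
    then have nz: "z\<^sup>2 - z * complex_of_real (1 + \<alpha> - \<gamma> * lam i) + complex_of_real \<alpha> \<noteq> 0" for i
      using roots[of i] z by auto
    have "((\<lambda>k. spectral_matrix u (\<lambda>i. z powi (- k) * complex_of_real (causal (mode_response \<gamma> (r i) (s i)) k)))
        has_sum sgdm_transfer \<gamma> \<alpha> A z) UNIV"
      unfolding sgdm_transfer_spectral[OF u A nz] by (intro has_sum_spectral_matrix)
        (use mode_transfer[OF z roots] sum prod in simp)
    then show ?thesis
      by (simp add: H_def complex_spectral_matrix spectral_matrix_mult[OF u] flip: spectral_matrix_one[OF u])
  qed
  have "G = H" if G: "\<And>z. cmod z = 1 \<Longrightarrow> ((\<lambda>k. mat (z powi (- k)) ** complex_matrix (G k)) has_sum sgdm_transfer \<gamma> \<alpha> A z) UNIV" for G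
  proof -
    have "complex_of_real (G m $ p $ q - H m $ p $ q) = 0" for m p q
    proof (rule Laurent_series_circle_unique)
      fix z assume z: "cmod z = 1"
      have "((\<lambda>k. (mat (z powi (- k)) ** complex_matrix (G k) - mat (z powi (- k)) ** complex_matrix (H k)) $ p $ q) has_sum
          (sgdm_transfer \<gamma> \<alpha> A z - sgdm_transfer \<gamma> \<alpha> A z) $ p $ q) UNIV"
        using has_sum_diff[OF G[OF z] H[OF z]] unfolding has_sum_vec_iff by blast
      then show "((\<lambda>k. z powi (- k) * complex_of_real (G k $ p $ q - H k $ p $ q)) has_sum 0) UNIV"
        by (simp add: mat_mult_component complex_matrix_def map_matrix_def algebra_simps)
    qed
    then show ?thesis by (simp add: fun_eq_iff vec_eq_iff)
  qed
  then have "sgdm_impulse_response \<gamma> \<alpha> A = H"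
    unfolding sgdm_impulse_response_def using H by (intro the_equality) auto
  then show ?thesis by (simp add: H_def[abs_def])
qed

text \<open>The square expands into geometric series with ratios \<open>r\<^sup>2\<close>,
  \<open>s\<^sup>2\<close> and \<open>r * s\<close>. The factorisation \<open>(1 - r\<^sup>2) * (1 -
  s\<^sup>2) = (1 + r * s)\<^sup>2 - (r + s)\<^sup>2\<close> puts their sum in terms of
  \<open>r + s\<close> and \<open>r * s\<close>, which the recursion prescribes.\<close>

lemma mode_response_energy:
  assumes "\<bar>r\<bar> < 1" "\<bar>s\<bar> < 1" "r \<noteq> s"
  shows "(\<lambda>m. (mode_response \<gamma> r s m)\<^sup>2) sums
    (\<gamma>\<^sup>2 * (1 + r * s) / ((1 - r * s) * ((1 + r * s)\<^sup>2 - (r + s)\<^sup>2)))"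
proof -
  have b: "\<bar>r\<^sup>2\<bar> < 1" "\<bar>s\<^sup>2\<bar> < 1" "\<bar>r * s\<bar> < 1"
    using assms abs_mult_less[of r 1 s 1] by (auto simp: abs_square_less_1 power_abs abs_mult)
  have nz: "1 - r\<^sup>2 \<noteq> 0" "1 - s\<^sup>2 \<noteq> 0" "1 - r * s \<noteq> 0" "r - s \<noteq> 0"
    using b assms(3) by auto
  have "(\<lambda>m. (\<gamma> / (r - s))\<^sup>2 * (((r\<^sup>2) ^ m + (s\<^sup>2) ^ m) - 2 * (r * s) ^ m)) sums
      ((\<gamma> / (r - s))\<^sup>2 * ((1 / (1 - r\<^sup>2) + 1 / (1 - s\<^sup>2)) - 2 * (1 / (1 - r * s))))"
    using b by (intro sums_mult sums_diff sums_add geometric_sums) auto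
  moreover have "(\<gamma> / (r - s))\<^sup>2 * (((r\<^sup>2) ^ m + (s\<^sup>2) ^ m) - 2 * (r * s) ^ m) = (mode_response \<gamma> r s m)\<^sup>2" for m
  proof -
    have "((r\<^sup>2) ^ m + (s\<^sup>2) ^ m) - 2 * (r * s) ^ m = (r ^ m - s ^ m)\<^sup>2"
      by (simp add: power2_diff power_mult_distrib mult_ac flip: power_mult)
    then show ?thesis
      by (simp add: mode_response_def power_divide power_mult_distrib)
  qed
  moreover have "(\<gamma> / (r - s))\<^sup>2 * ((1 / (1 - r\<^sup>2) + 1 / (1 - s\<^sup>2)) - 2 * (1 / (1 - r * s))) =
      \<gamma>\<^sup>2 * (1 + r * s) / ((1 - r * s) * ((1 + r * s)\<^sup>2 - (r + s)\<^sup>2))"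
  proof -
    have "(1 / (1 - r\<^sup>2) + 1 / (1 - s\<^sup>2)) - 2 * (1 / (1 - r * s)) =
        (r - s)\<^sup>2 * (1 + r * s) / ((1 - r * s) * ((1 - r\<^sup>2) * (1 - s\<^sup>2)))"
      using nz by (simp add: divide_simps) (simp add: algebra_simps power2_eq_square)
    moreover have "(1 - r\<^sup>2) * (1 - s\<^sup>2) = (1 + r * s)\<^sup>2 - (r + s)\<^sup>2"
      by (simp add: algebra_simps power2_eq_square)
    ultimately show ?thesis using nz by (simp add: power_divide)
  qed
  ultimately show ?thesis by simp
qed

lemma summable_mode_response:
  assumes "\<bar>r\<bar> < 1" "\<bar>s\<bar> < 1"
  shows "summable (\<lambda>m. \<bar>mode_response \<gamma> r s m\<bar>)"
proof (rule summable_comparison_test')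
  show "summable (\<lambda>m. \<bar>\<gamma> / (r - s)\<bar> * (\<bar>r\<bar> ^ m + \<bar>s\<bar> ^ m))"
    using assms by (intro summable_mult summable_add summable_geometric) auto
  show "norm \<bar>mode_response \<gamma> r s m\<bar> \<le> \<bar>\<gamma> / (r - s)\<bar> * (\<bar>r\<bar> ^ m + \<bar>s\<bar> ^ m)" for m
    using abs_triangle_ineq4[of "r ^ m" "s ^ m"]
    by (simp add: mode_response_def abs_mult power_abs mult_left_mono divide_right_mono)
qed

subsection \<open>Moments of the noise\<close>

context prob_space
begin

text \<open>All partial sums are bounded by \<open>B * (\<Sum>m. \<bar>h m\<bar>)\<close>, so
  dominated convergence carries their mean and second moment to the limit; the cross terms of the
  second moment vanish.\<close>

lemma uncorrelated_series:
  fixes Y :: "nat \<Rightarrow> 'a \<Rightarrow> real"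
  assumes Y [measurable]: "\<And>m. random_variable borel (Y m)"
    and bounded: "\<And>m \<omega>. \<omega> \<in> space M \<Longrightarrow> \<bar>Y m \<omega>\<bar> \<le> B"
    and mean: "\<And>m. expectation (Y m) = 0"
    and second: "\<And>m. expectation (\<lambda>\<omega>. (Y m \<omega>)\<^sup>2) = v"
    and uncorrelated: "\<And>m l. m \<noteq> l \<Longrightarrow> expectation (\<lambda>\<omega>. Y m \<omega> * Y l \<omega>) = 0"
    and h: "summable (\<lambda>m. \<bar>h m\<bar>)"
  shows "random_variable borel (\<lambda>\<omega>. \<Sum>m. h m * Y m \<omega>)"
    and "\<And>\<omega>. \<omega> \<in> space M \<Longrightarrow> summable (\<lambda>m. \<bar>h m * Y m \<omega>\<bar>)"
    and "\<And>\<omega>. \<omega> \<in> space M \<Longrightarrow> \<bar>\<Sum>m. h m * Y m \<omega>\<bar> \<le> B * (\<Sum>m. \<bar>h m\<bar>)"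
    and "expectation (\<lambda>\<omega>. \<Sum>m. h m * Y m \<omega>) = 0"
    and "(\<lambda>m. v * (h m)\<^sup>2) sums expectation (\<lambda>\<omega>. (\<Sum>m. h m * Y m \<omega>)\<^sup>2)"
proof -
  define S where "S N \<omega> = (\<Sum>m<N. h m * Y m \<omega>)" for N \<omega>
  define Z where "Z \<omega> = (\<Sum>m. h m * Y m \<omega>)" for \<omega>
  define C where "C = B * (\<Sum>m. \<bar>h m\<bar>)"
  have term_le: "\<bar>h m * Y m \<omega>\<bar> \<le> B * \<bar>h m\<bar>" if "\<omega> \<in> space M" for m \<omega>
    using mult_left_mono[OF bounded[OF that, of m], of "\<bar>h m\<bar>"] by (simp add: abs_mult mult_ac)
  show summable: "summable (\<lambda>m. \<bar>h m * Y m \<omega>\<bar>)" if "\<omega> \<in> space M" for \<omega>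
    by (rule summable_comparison_test'[OF summable_mult[OF h, of B]]) (use term_le that in auto)
  have lim: "(\<lambda>N. S N \<omega>) \<longlonglongrightarrow> Z \<omega>" if "\<omega> \<in> space M" for \<omega>
    unfolding S_def Z_def by (rule summable_LIMSEQ[OF summable_rabs_cancel[OF summable[OF that]]])
  have S_le: "\<bar>S N \<omega>\<bar> \<le> C" if "\<omega> \<in> space M" for N \<omega>
  proof -
    have "\<bar>S N \<omega>\<bar> \<le> (\<Sum>m<N. B * \<bar>h m\<bar>)"
      unfolding S_def using term_le[OF that] by (intro order.trans[OF sum_abs] sum_mono)
    also have "\<dots> \<le> (\<Sum>m. B * \<bar>h m\<bar>)"
      using order.trans[OF abs_ge_zero term_le[OF that]] by (intro sum_le_suminf summable_mult h) auto
    finally show ?thesis by (simp add: C_def suminf_mult[OF h])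
  qed
  show "\<bar>\<Sum>m. h m * Y m \<omega>\<bar> \<le> B * (\<Sum>m. \<bar>h m\<bar>)" if "\<omega> \<in> space M" for \<omega>
    using tendsto_upperbound[OF tendsto_rabs[OF lim[OF that]], of C] S_le[OF that]
    by (simp add: C_def Z_def)
  have S_meas [measurable]: "random_variable borel (S N)" for N
    unfolding S_def[abs_def] by measurable
  show Z_meas: "random_variable borel (\<lambda>\<omega>. \<Sum>m. h m * Y m \<omega>)"
    by (rule borel_measurable_LIMSEQ_real[OF _ S_meas]) (use lim Z_def in auto)
  have Y_int: "integrable M (Y m)" for m
    using bounded by (intro integrable_const_bound[of _ B]) auto
  have YY_int: "integrable M (\<lambda>\<omega>. Y m \<omega> * Y l \<omega>)" for m l
    using bounded by (intro integrable_const_bound[of _ "B * B"]) (auto simp: abs_mult intro!: mult_mono')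
  have "expectation (S N) = 0" for N
    unfolding S_def[abs_def] using Y_int by (simp add: mean)
  moreover have "(\<lambda>N. expectation (S N)) \<longlonglongrightarrow> expectation Z"
    by (rule integral_dominated_convergence[where w="\<lambda>_. C"])
      (use Z_meas lim S_le in \<open>auto simp: Z_def[abs_def]\<close>)
  ultimately show "expectation (\<lambda>\<omega>. \<Sum>m. h m * Y m \<omega>) = 0"
    by (simp add: LIMSEQ_const_iff Z_def[abs_def])
  have "expectation (\<lambda>\<omega>. (S N \<omega>)\<^sup>2) = (\<Sum>m<N. v * (h m)\<^sup>2)" for N
  proof -
    have "expectation (\<lambda>\<omega>. (S N \<omega>)\<^sup>2) = expectation (\<lambda>\<omega>. \<Sum>m<N. \<Sum>l<N. (h m * h l) * (Y m \<omega> * Y l \<omega>))"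
      by (simp add: S_def power2_eq_square sum_product mult_ac)
    also have "\<dots> = (\<Sum>m<N. \<Sum>l<N. (h m * h l) * expectation (\<lambda>\<omega>. Y m \<omega> * Y l \<omega>))"
      using YY_int by simp
    also have "\<dots> = (\<Sum>m<N. \<Sum>l<N. if m = l then v * (h m)\<^sup>2 else 0)"
      using second uncorrelated by (intro sum.cong refl) (auto simp: power2_eq_square)
    finally show ?thesis by simp
  qed
  moreover have "(\<lambda>N. expectation (\<lambda>\<omega>. (S N \<omega>)\<^sup>2)) \<longlonglongrightarrow> expectation (\<lambda>\<omega>. (Z \<omega>)\<^sup>2)"
    by (rule integral_dominated_convergence[where w="\<lambda>_. C\<^sup>2"])
      (use Z_meas lim power_mono[OF S_le abs_ge_zero, where n=2] in \<open>auto simp: Z_def[abs_def] intro!: tendsto_power\<close>)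
  ultimately show "(\<lambda>m. v * (h m)\<^sup>2) sums expectation (\<lambda>\<omega>. (\<Sum>m. h m * Y m \<omega>)\<^sup>2)"
    by (simp add: sums_def Z_def)
qed

end

section \<open>Expectations over uniform indices, and averages of the gradient noise\<close>

lemma iid_uniform_expectation:
  fixes f :: "nat \<Rightarrow> real"
  assumes "iid_uniform_indices n M I"
  shows "integral\<^sup>L M (\<lambda>\<omega>. f (I k \<omega>)) = average n f"
proof -
  interpret prob_space M using assms by (simp add: iid_uniform_indices_def)
  have "I k \<in> measurable M (count_space {1..n})"
    using assms by (auto simp: iid_uniform_indices_def indep_vars_def)
  then have "integral\<^sup>L M (\<lambda>\<omega>. f (I k \<omega>)) = integral\<^sup>L (distr M (count_space {1..n}) (I k)) f"
    by (subst integral_distr) auto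
  also have "\<dots> = average n f"
    using assms by (simp add: iid_uniform_indices_def integral_uniform_count_measure average_def)
  finally show ?thesis .
qed

lemma iid_uniform_product_expectation:
  fixes f :: "nat \<Rightarrow> real"
  assumes iid: "iid_uniform_indices n M I" and "j \<noteq> k"
  shows "integral\<^sup>L M (\<lambda>\<omega>. f (I j \<omega>) * f (I k \<omega>)) = average n f * average n f"
proof -
  interpret prob_space M using iid by (simp add: iid_uniform_indices_def)
  have "indep_vars (\<lambda>_. borel) (\<lambda>i \<omega>. f (I i \<omega>)) UNIV"
    using iid by (intro indep_vars_compose2[where M'="\<lambda>_. count_space {1..n}" and X=I and Y="\<lambda>_. f"]) (auto simp: iid_uniform_indices_def)
  then have indep: "indep_vars (\<lambda>_. borel) (\<lambda>i \<omega>. f (I i \<omega>)) {j, k}"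
    by (rule indep_vars_subset) simp
  have I: "I i \<in> measurable M (count_space {1..n})" for i
    using iid by (auto simp: iid_uniform_indices_def indep_vars_def)
  have "integrable M (\<lambda>\<omega>. f (I i \<omega>))" for i
  proof (rule integrable_const_bound)
    \<comment> \<open>Measurability confines the index to \<open>{1..n}\<close>, so a finite sum
      bounds \<open>f\<close> although \<open>f\<close> is arbitrary outside that range.\<close>
    show "AE \<omega> in M. norm (f (I i \<omega>)) \<le> (\<Sum>i\<in>{1..n}. \<bar>f i\<bar>)"
      using measurable_space[OF I] by (auto intro!: member_le_sum)
    show "random_variable borel (\<lambda>\<omega>. f (I i \<omega>))"
      by (rule measurable_compose[OF I]) simp
  qed
  with indep_vars_lebesgue_integral[OF _ indep] \<open>j \<noteq> k\<close> show ?thesis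
    by (simp add: iid_uniform_expectation[OF iid])
qed

text \<open>This identifies the quadratic form of the noise covariance along \<open>u\<close> with
  the second moment of the noise component along \<open>u\<close>.\<close>

lemma average_outer_square:
  "u \<bullet> (average n (\<lambda>i. outer_square (y i)) *v u) = average n (\<lambda>i. (u \<bullet> y i)\<^sup>2)"
proof -
  have outer: "outer_square v *v w = (v \<bullet> w) *\<^sub>R v" for v w :: "real^'a"
    by (simp add: outer_square_def matrix_vector_mult_def vec_eq_iff inner_vec_def sum_distrib_right sum_distrib_left mult_ac)
  have "(\<Sum>i\<in>F. outer_square (y i)) *v u = (\<Sum>i\<in>F. outer_square (y i) *v u)" for F
    by (induction F rule: infinite_finite_induct) (auto simp: matrix_vector_mult_add_rdistrib)
  then show ?thesis
    by (simp add: average_def outer inner_sum_right power2_eq_square inner_commute flip: scaleR_matrix_vector_assoc)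
qed

text \<open>The noise vector with index \<open>i\<close> is the gradient of the \<open>i\<close>-th
  summand at the minimizer of the mean objective, and the mean gradient vanishes there.\<close>

lemma average_grad_noise:
  assumes "average n A ** matrix_inv (average n A) = mat 1"
  shows "average n (grad_noise n A b) = 0"
proof -
  have mv: "(\<Sum>i\<in>F. A i) *v w = (\<Sum>i\<in>F. A i *v w)" for F w
    by (induction F rule: infinite_finite_induct) (auto simp: matrix_vector_mult_add_rdistrib)
  define w where "w = matrix_inv (average n A) *v average n b"
  have "grad_noise n A b = (\<lambda>i. b i - A i *v w)"
    by (simp add: grad_noise_def w_def fun_eq_iff)
  then have "average n (grad_noise n A b) = average n b - average n A *v w"
    by (simp add: average_def mv sum_subtractf scaleR_diff_right flip: scaleR_matrix_vector_assoc)
  also have "average n A *v w = average n b"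
    by (simp add: w_def matrix_vector_mul_assoc assms)
  finally show ?thesis by simp
qed

lemma average_inner: "average n (\<lambda>i. u \<bullet> y i) = u \<bullet> average n y"
  by (simp add: average_def inner_sum_right)

lemma pos_definite_inverse:
  fixes u :: "'d::finite \<Rightarrow> real^'d"
  assumes u: "orthonormal_family u" and A: "\<And>i. A *v u i = lam i *\<^sub>R u i" and lam: "\<And>i. lam i > 0"
  shows "A ** matrix_inv A = mat 1"
proof -
  have "lam i \<noteq> 0" for i using lam[of i] by simp
  then have "A ** spectral_matrix u (\<lambda>i. 1 / lam i) = mat 1" "spectral_matrix u (\<lambda>i. 1 / lam i) ** A = mat 1"
    by (simp_all add: spectral_decomposition[OF u A] spectral_matrix_mult[OF u] spectral_matrix_one[OF u])
  then show ?thesis by (simp add: matrix_inv_unique)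
qed

subsection \<open>Variance of the stationary iterates\<close>

lemma trace_outer_square: "trace (outer_square v) = v \<bullet> v"
  by (simp add: trace_def outer_square_def inner_vec_def)

lemma bounded_linear_trace: "bounded_linear (trace :: real^'n^'n \<Rightarrow> real)"
  unfolding trace_def[abs_def]
  by (intro bounded_linear_sum bounded_linear_compose[OF bounded_linear_vec_nth bounded_linear_vec_nth])

text \<open>By causality only inputs at times \<open>k - m\<close> with \<open>m \<ge> 0\<close>
  contribute, so the unordered sum over the integers becomes an ordinary series in each mode. The
  reflection \<open>j \<mapsto> k - j\<close> matches the two indexings.\<close>

lemma sgdm_iterate_modes:
  fixes u :: "'d::finite \<Rightarrow> real^'d"
  assumes impulse: "sgdm_impulse_response \<gamma> \<alpha> (average n A) = (\<lambda>k. spectral_matrix u (\<lambda>i. causal (h i) k))"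
    and summable: "\<And>i. summable (\<lambda>m. \<bar>h i m * (u i \<bullet> grad_noise n A b (I (k - int m) \<omega>))\<bar>)"
  shows "sgdm_iterate \<gamma> \<alpha> n A b I k \<omega> = minimizer n A b +
    (\<Sum>i\<in>UNIV. (\<Sum>m. h i m * (u i \<bullet> grad_noise n A b (I (k - int m) \<omega>))) *\<^sub>R u i)"
proof -
  let ?y = "\<lambda>j. grad_noise n A b (I j \<omega>)"
  have "((\<lambda>j. causal (h i) (k - j) * (u i \<bullet> ?y j)) has_sum (\<Sum>m. h i m * (u i \<bullet> ?y (k - int m)))) UNIV" for i
  proof -
    have "((\<lambda>m. h i m * (u i \<bullet> ?y (k - int m))) has_sum (\<Sum>m. h i m * (u i \<bullet> ?y (k - int m)))) UNIV"
      using summable[of i] by (intro norm_summable_imp_has_sum summable_sums) (auto intro: summable_rabs_cancel)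
    then have "((\<lambda>j. causal (h i) j * (u i \<bullet> ?y (k - j))) has_sum (\<Sum>m. h i m * (u i \<bullet> ?y (k - int m)))) UNIV"
      by (subst has_sum_int_iff_nat) (auto simp: causal_def)
    moreover have "bij (\<lambda>j. k - j)"
      by (rule bij_betw_byWitness[where f'="\<lambda>j. k - j"]) auto
    ultimately show ?thesis
      using has_sum_reindex_bij_betw[of "\<lambda>j. k - j" UNIV UNIV "\<lambda>j. causal (h i) j * (u i \<bullet> ?y (k - j))"] by simp
  qed
  then have "((\<lambda>j. \<Sum>i\<in>UNIV. (causal (h i) (k - j) * (u i \<bullet> ?y j)) *\<^sub>R u i) has_sum
      (\<Sum>i\<in>UNIV. (\<Sum>m. h i m * (u i \<bullet> ?y (k - int m))) *\<^sub>R u i)) UNIV"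
    by (intro has_sum_sum has_sum_bounded_linear[OF bounded_linear_scaleR_left])
  then show ?thesis
    by (simp add: sgdm_iterate_def impulse spectral_matrix_vector_mult infsumI)
qed

text \<open>The trace of the covariance is the mean squared norm of the deviation, which Parseval
  splits into one second moment per mode; correlations between modes do not enter.\<close>

lemma trace_var_orthogonal_modes:
  fixes u :: "'d::finite \<Rightarrow> real^'d"
  assumes M: "prob_space M" and u: "orthonormal_family u"
    and X: "\<And>\<omega>. \<omega> \<in> space M \<Longrightarrow> X \<omega> = x + (\<Sum>i\<in>UNIV. Z i \<omega> *\<^sub>R u i)"
    and Z [measurable]: "\<And>i. Z i \<in> borel_measurable M"
    and bounded: "\<And>i \<omega>. \<omega> \<in> space M \<Longrightarrow> \<bar>Z i \<omega>\<bar> \<le> B i"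
    and mean: "\<And>i. integral\<^sup>L M (Z i) = 0"
  shows "trace (var_matrix M X) = (\<Sum>i\<in>UNIV. integral\<^sup>L M (\<lambda>\<omega>. (Z i \<omega>)\<^sup>2))"
proof -
  interpret prob_space M by (fact M)
  define D where "D \<omega> = (\<Sum>i\<in>UNIV. Z i \<omega> *\<^sub>R u i)" for \<omega>
  have Z_int: "integrable M (Z i)" for i
    using bounded[of _ i] by (intro integrable_const_bound[of _ "B i"]) auto
  have ZZ_int: "integrable M (\<lambda>\<omega>. Z i \<omega> * Z j \<omega>)" for i j
    using bounded by (intro integrable_const_bound[of _ "B i * B j"]) (auto simp: abs_mult intro!: mult_mono')
  have "expectation X = expectation (\<lambda>\<omega>. x + D \<omega>)"
    by (intro Bochner_Integration.integral_cong) (auto simp: X D_def)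
  also have "\<dots> = x"
    using Z_int by (simp add: D_def mean prob_space)
  finally have "var_matrix M X = expectation (\<lambda>\<omega>. outer_square (D \<omega>))"
    unfolding var_matrix_def by (intro Bochner_Integration.integral_cong) (auto simp: X D_def)
  moreover have "integrable M (\<lambda>\<omega>. outer_square (D \<omega>))"
  proof -
    \<comment> \<open>A finite combination of constant matrices reduces integrability to that of the
      scalar products \<open>Z i \<omega> * Z j \<omega>\<close>; it is needed to exchange trace and
      expectation.\<close>
    have "outer_square (D \<omega>) = (\<Sum>i\<in>UNIV. \<Sum>j\<in>UNIV. (Z i \<omega> * Z j \<omega>) *\<^sub>R (\<chi> p q. u i $ p * u j $ q))" for \<omega>
      by (simp add: outer_square_def D_def vec_eq_iff sum_product mult_ac)
    with ZZ_int show ?thesis by simp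
  qed
  ultimately have "trace (var_matrix M X) = expectation (\<lambda>\<omega>. trace (outer_square (D \<omega>)))"
    by (simp add: integral_bounded_linear[OF bounded_linear_trace])
  also have "\<dots> = expectation (\<lambda>\<omega>. \<Sum>i\<in>UNIV. (Z i \<omega>)\<^sup>2)"
  proof -
    have "u i \<bullet> D \<omega> = Z i \<omega>" for i \<omega>
    proof -
      have "u i \<bullet> D \<omega> = (\<Sum>j\<in>UNIV. if i = j then Z j \<omega> else 0)"
        unfolding D_def inner_sum_right using u
        by (intro sum.cong refl) (simp add: orthonormal_family_def)
      then show ?thesis by simp
    qed
    then show ?thesis by (simp add: trace_outer_square orthonormal_parseval[OF u])
  qed
  also have "\<dots> = (\<Sum>i\<in>UNIV. expectation (\<lambda>\<omega>. (Z i \<omega>)\<^sup>2))"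
    using ZZ_int by (simp add: power2_eq_square)
  finally show ?thesis .
qed

text \<open>Along \<open>u i\<close> the input is centred, uncorrelated in time and of constant
  variance, so filtering by \<open>h i\<close> multiplies that variance by the energy
  \<open>e i\<close>.\<close>

lemma trace_var_sgdm:
  fixes u :: "'d::finite \<Rightarrow> real^'d"
  assumes u: "orthonormal_family u" and A: "\<And>i. average n A *v u i = lam i *\<^sub>R u i" and lam: "\<And>i. lam i > 0"
    and iid: "iid_uniform_indices n M I"
    and impulse: "sgdm_impulse_response \<gamma> \<alpha> (average n A) = (\<lambda>k. spectral_matrix u (\<lambda>i. causal (h i) k))"
    and h: "\<And>i. summable (\<lambda>m. \<bar>h i m\<bar>)"
    and energy: "\<And>i. (\<lambda>m. (h i m)\<^sup>2) sums e i"
  shows "trace (var_matrix M (sgdm_iterate \<gamma> \<alpha> n A b I k)) =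
    (\<Sum>i\<in>UNIV. (u i \<bullet> (noise_cov n A b *v u i)) * e i)"
proof -
  interpret prob_space M using iid by (simp add: iid_uniform_indices_def)
  define f where "f i j = u i \<bullet> grad_noise n A b j" for i j
  define B where "B i = (\<Sum>j\<in>{1..n}. \<bar>f i j\<bar>)" for i
  define v where "v i = u i \<bullet> (noise_cov n A b *v u i)" for i
  have I: "I j \<in> measurable M (count_space {1..n})" for j
    using iid by (auto simp: iid_uniform_indices_def indep_vars_def)
  have f_avg: "average n (f i) = 0" for i
    by (simp add: f_def[abs_def] average_inner average_grad_noise pos_definite_inverse[OF u A lam])
  have v: "average n (\<lambda>j. (f i j)\<^sup>2) = v i" for i
    by (simp add: v_def noise_cov_def average_outer_square f_def)
  have Y: "random_variable borel (\<lambda>\<omega>. f i (I (k - int m) \<omega>))"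
    "\<omega> \<in> space M \<Longrightarrow> \<bar>f i (I (k - int m) \<omega>)\<bar> \<le> B i"
    "expectation (\<lambda>\<omega>. f i (I (k - int m) \<omega>)) = 0"
    "expectation (\<lambda>\<omega>. (f i (I (k - int m) \<omega>))\<^sup>2) = v i"
    "m \<noteq> l \<Longrightarrow> expectation (\<lambda>\<omega>. f i (I (k - int m) \<omega>) * f i (I (k - int l) \<omega>)) = 0" for i m l \<omega>
  proof -
    show "random_variable borel (\<lambda>\<omega>. f i (I (k - int m) \<omega>))"
      by (rule measurable_compose[OF I]) simp
    show "\<bar>f i (I (k - int m) \<omega>)\<bar> \<le> B i" if "\<omega> \<in> space M"
      unfolding B_def using measurable_space[OF I that] by (intro member_le_sum) auto
    show "expectation (\<lambda>\<omega>. f i (I (k - int m) \<omega>)) = 0"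
      by (simp add: iid_uniform_expectation[OF iid] f_avg)
    show "expectation (\<lambda>\<omega>. (f i (I (k - int m) \<omega>))\<^sup>2) = v i"
      using iid_uniform_expectation[OF iid, of "\<lambda>j. (f i j)\<^sup>2"] v by simp
    show "expectation (\<lambda>\<omega>. f i (I (k - int m) \<omega>) * f i (I (k - int l) \<omega>)) = 0" if "m \<noteq> l"
      using that by (simp add: iid_uniform_product_expectation[OF iid] f_avg)
  qed
  define Z where "Z i \<omega> = (\<Sum>m. h i m * f i (I (k - int m) \<omega>))" for i \<omega>
  have series: "random_variable borel (Z i)"
    "\<omega> \<in> space M \<Longrightarrow> summable (\<lambda>m. \<bar>h i m * f i (I (k - int m) \<omega>)\<bar>)"
    "\<omega> \<in> space M \<Longrightarrow> \<bar>Z i \<omega>\<bar> \<le> B i * (\<Sum>m. \<bar>h i m\<bar>)"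
    "expectation (Z i) = 0"
    "(\<lambda>m. v i * (h i m)\<^sup>2) sums expectation (\<lambda>\<omega>. (Z i \<omega>)\<^sup>2)" for i \<omega>
    unfolding Z_def[abs_def]
    by (rule uncorrelated_series[where B="B i" and v="v i" and h="h i" and Y="\<lambda>m \<omega>. f i (I (k - int m) \<omega>)"];
        simp add: Y h)+
  have "trace (var_matrix M (sgdm_iterate \<gamma> \<alpha> n A b I k)) = (\<Sum>i\<in>UNIV. expectation (\<lambda>\<omega>. (Z i \<omega>)\<^sup>2))"
  proof (rule trace_var_orthogonal_modes[OF _ u])
    show "sgdm_iterate \<gamma> \<alpha> n A b I k \<omega> = minimizer n A b + (\<Sum>i\<in>UNIV. Z i \<omega> *\<^sub>R u i)" if "\<omega> \<in> space M" for \<omega>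
      using sgdm_iterate_modes[OF impulse, of b I k \<omega>] series(2)[OF that] by (simp add: Z_def f_def)
    show "random_variable borel (Z i)" "expectation (Z i) = 0" for i
      by (fact series)+
    show "\<bar>Z i \<omega>\<bar> \<le> B i * (\<Sum>m. \<bar>h i m\<bar>)" if "\<omega> \<in> space M" for i \<omega>
      by (rule series(3)[OF that])
  qed (fact prob_space_axioms)
  also have "\<dots> = (\<Sum>i\<in>UNIV. v i * e i)"
    using sums_unique2[OF series(5) sums_mult[OF energy]] by (simp add: Z_def)
  finally show ?thesis by (simp add: v_def)
qed

subsection \<open>Expansions for small \<open>\<gamma> \<lambda>\<close>\<close>

text \<open>The discriminant is at least \<open>(1 - \<alpha>)\<^sup>2 - 4 * t\<close>, which the
  bound on \<open>t\<close> makes positive, so the quadratic formula gives distinct real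
  roots.\<close>

lemma characteristic_roots:
  fixes \<alpha> t :: real
  assumes "0 \<le> \<alpha>" "\<alpha> < 1" "0 < t" "t \<le> (1 - \<alpha>)\<^sup>2 / 8"
  obtains r s where "\<bar>r\<bar> < 1" "\<bar>s\<bar> < 1" "r \<noteq> s" "r + s = 1 + \<alpha> - t" "r * s = \<alpha>"
proof -
  define d where "d = sqrt ((1 + \<alpha> - t)\<^sup>2 - 4 * \<alpha>)"
  have sq: "(1 - \<alpha>)\<^sup>2 \<le> 1"
    using assms by (intro power_le_one) auto
  have \<alpha>t: "\<alpha> * t \<le> 1 * t"
    using assms by (intro mult_right_mono) auto
  have pos: "(1 + \<alpha> - t)\<^sup>2 - 4 * \<alpha> > 0"
  proof -
    have "(1 + \<alpha> - t)\<^sup>2 - 4 * \<alpha> = (1 - \<alpha>)\<^sup>2 + t\<^sup>2 - 2 * t - 2 * (\<alpha> * t)"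
      by (simp add: power2_eq_square algebra_simps)
    with \<alpha>t show ?thesis
      using assms(3,4) zero_le_power2[of t] by linarith
  qed
  then have d: "d > 0" "d\<^sup>2 = (1 + \<alpha> - t)\<^sup>2 - 4 * \<alpha>" by (auto simp: d_def)
  \<comment> \<open>In this form the discriminant shows \<open>d < 1 - \<alpha> + t\<close>, which
    says that the larger root is below 1. The bound \<open>d \<le> 1 + \<alpha> - t\<close> further
    down says that the smaller root is nonnegative.\<close>
  have "(1 + \<alpha> - t)\<^sup>2 - 4 * \<alpha> = (1 - \<alpha> + t)\<^sup>2 - 4 * t"
    by (simp add: power2_eq_square algebra_simps)
  then have "d < 1 - \<alpha> + t"
    using assms by (intro power2_less_imp_less[of d "1 - \<alpha> + t"]) (auto simp: d)
  moreover have "d \<le> 1 + \<alpha> - t"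
    using assms sq by (intro power2_le_imp_le[of d]) (auto simp: d)
  ultimately show ?thesis
    using d assms(1-3)
    by (intro that[of "(1 + \<alpha> - t + d) / 2" "(1 + \<alpha> - t - d) / 2"])
      (auto simp: field_simps power2_eq_square)
qed

lemma rho_square:
  assumes "(1 - \<alpha>)\<^sup>2 + (\<gamma> * l)\<^sup>2 - 2 * (1 + \<alpha>) * (\<gamma> * l) = s\<^sup>2" "0 \<le> s"
  shows "rho_plus \<gamma> \<alpha> l = ((1 - \<alpha> + s) / (\<gamma> * l))\<^sup>2"
    and "rho_minus \<gamma> \<alpha> l = ((1 - \<alpha> - s) / (\<gamma> * l))\<^sup>2"
proof -
  have "sqrt ((1 - \<alpha>)\<^sup>2 + \<gamma>\<^sup>2 * l\<^sup>2 - 2 * (1 + \<alpha>) * \<gamma> * l) = s"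
    using assms by (intro real_sqrt_unique) (auto simp: power_mult_distrib)
  moreover have "2 * (1 - \<alpha>)\<^sup>2 + \<gamma>\<^sup>2 * l\<^sup>2 - 2 * (1 + \<alpha>) * \<gamma> * l = (1 - \<alpha>)\<^sup>2 + s\<^sup>2"
    using assms(1) by (simp add: power_mult_distrib)
  ultimately show "rho_plus \<gamma> \<alpha> l = ((1 - \<alpha> + s) / (\<gamma> * l))\<^sup>2" "rho_minus \<gamma> \<alpha> l = ((1 - \<alpha> - s) / (\<gamma> * l))\<^sup>2"
    by (simp_all add: rho_plus_def rho_minus_def power_divide power_mult_distrib power2_sum power2_diff)
qed

text \<open>With \<open>a = 1 - \<alpha>\<close> and \<open>t = \<gamma> * l\<close>, the identity
  \<open>(a - s) * (a + s) = \<beta> * t\<close> gives \<open>a - s = O(t)\<close>. For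
  \<open>rho_plus\<close> this permits replacing \<open>s\<close> by \<open>a\<close>; for
  \<open>rho_minus\<close> it rationalises \<open>(a - s) / t\<close> to
  \<open>\<beta> / (a + s)\<close>, whose value at \<open>t = 0\<close> is
  \<open>(1 + \<alpha>) / a\<close>.\<close>

lemma rho_expansion:
  assumes \<alpha>: "0 \<le> \<alpha>" "\<alpha> < 1" and t: "0 < \<gamma> * l" "\<gamma> * l \<le> (1 - \<alpha>)\<^sup>2 / 8"
  shows "\<bar>rho_plus \<gamma> \<alpha> l - 4 * (1 - \<alpha>)\<^sup>2 / (\<gamma>\<^sup>2 * l\<^sup>2)\<bar> \<le> 54 / (1 - \<alpha>) ^ 4 * (1 / (\<gamma> * l))"
    and "\<bar>rho_minus \<gamma> \<alpha> l - ((1 + \<alpha>) / (1 - \<alpha>))\<^sup>2\<bar> \<le> 54 / (1 - \<alpha>) ^ 4 * (\<gamma> * l)"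
proof -
  define a where "a = 1 - \<alpha>"
  define t where "t = \<gamma> * l"
  define s where "s = sqrt (a\<^sup>2 + t\<^sup>2 - 2 * (1 + \<alpha>) * t)"
  define \<beta> where "\<beta> = 2 * (1 + \<alpha>) - t"
  have a: "0 < a" "a \<le> 1" using \<alpha> by (auto simp: a_def)
  have a2: "a\<^sup>2 \<le> 1" using a by (intro power_le_one) auto
  have t0: "0 < t" "t \<le> a\<^sup>2 / 8" using assms by (auto simp: t_def a_def)
  have \<beta>: "1 \<le> \<beta>" "\<beta> \<le> 4" using t0 a2 \<alpha> by (auto simp: \<beta>_def)
  have \<beta>t: "0 < \<beta> * t" "\<beta> * t \<le> 4 * t" using \<beta> t0 by auto
  have s2: "s\<^sup>2 = a\<^sup>2 - \<beta> * t"
  proof -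
    have "a\<^sup>2 + t\<^sup>2 - 2 * (1 + \<alpha>) * t = a\<^sup>2 - \<beta> * t"
      by (simp add: \<beta>_def power2_eq_square algebra_simps)
    moreover have "0 \<le> a\<^sup>2 - \<beta> * t" using \<beta>t t0 zero_le_power2[of a] by linarith
    ultimately show ?thesis by (simp add: s_def)
  qed
  have "0 \<le> a\<^sup>2 - \<beta> * t" using s2 zero_le_power2[of s] by linarith
  then have s: "0 \<le> s"
    by (simp add: s_def \<beta>_def power2_eq_square algebra_simps)
  have sa: "s \<le> a" using s2 \<beta>t a by (intro power2_le_imp_le[of s a]) auto
  have diff: "(a - s) * (a + s) = \<beta> * t" using s2 by (simp add: power2_eq_square algebra_simps)
  have as: "0 < a + s" using a s by simp
  have "(1 - \<alpha>)\<^sup>2 + (\<gamma> * l)\<^sup>2 - 2 * (1 + \<alpha>) * (\<gamma> * l) = s\<^sup>2"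
    by (simp add: s2 \<beta>_def flip: a_def t_def) (simp add: power2_eq_square algebra_simps)
  note rho = rho_square[OF this s, folded a_def t_def]
  have as_le: "a * (a - s) \<le> 4 * t"
    using diff \<beta>t mult_nonneg_nonneg[of "a - s" s] sa s by (simp add: algebra_simps)
  \<comment> \<open>The bound for \<open>rho_plus\<close> only produces 12; enlarging it lets one
    constant serve both estimates.\<close>
  have a4: "12 \<le> 54 / a ^ 4" "a ^ 4 \<le> 1"
  proof -
    show "a ^ 4 \<le> 1" using a by (intro power_le_one) auto
    then show "12 \<le> 54 / a ^ 4" using a by (simp add: field_simps)
  qed
  have "\<bar>rho_plus \<gamma> \<alpha> l - 4 * a\<^sup>2 / t\<^sup>2\<bar> = (4 * a\<^sup>2 - (a + s)\<^sup>2) / t\<^sup>2"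
  proof -
    have "(a + s)\<^sup>2 \<le> (2 * a)\<^sup>2" using sa as by (intro power_mono) auto
    then show ?thesis
      by (simp add: rho power_divide diff_divide_distrib[symmetric])
  qed
  also have "\<dots> \<le> 12 * t / t\<^sup>2"
  proof (intro divide_right_mono)
    \<comment> \<open>The two summands are at most \<open>8 * t\<close> and
      \<open>4 * t\<close>.\<close>
    have "4 * a\<^sup>2 - (a + s)\<^sup>2 = 2 * (a * (a - s)) + \<beta> * t"
      using s2 by (simp add: power2_eq_square algebra_simps)
    then show "4 * a\<^sup>2 - (a + s)\<^sup>2 \<le> 12 * t" using as_le \<beta>t by linarith
  qed simp
  also have "\<dots> = 12 * (1 / t)" by (simp add: power2_eq_square)
  also have "\<dots> \<le> 54 / a ^ 4 * (1 / t)"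
    using a4 t0 by (intro mult_right_mono) auto
  finally show "\<bar>rho_plus \<gamma> \<alpha> l - 4 * (1 - \<alpha>)\<^sup>2 / (\<gamma>\<^sup>2 * l\<^sup>2)\<bar> \<le> 54 / (1 - \<alpha>) ^ 4 * (1 / (\<gamma> * l))"
    by (simp add: a_def t_def power_mult_distrib)
  define p where "p = \<beta> / (a + s)"
  define q where "q = (1 + \<alpha>) / a"
  have "(a - s) / t = p"
    using diff as t0 by (simp add: p_def field_simps)
  then have rho_m: "rho_minus \<gamma> \<alpha> l = p\<^sup>2" by (simp add: rho)
  have "p - q = ((1 + \<alpha>) * (a - s) - t * a) / (a * (a + s))"
    using a as by (simp add: p_def q_def \<beta>_def field_simps)
  then have "\<bar>p - q\<bar> = \<bar>(1 + \<alpha>) * (a - s) - t * a\<bar> / (a * (a + s))"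
    using a as by (simp add: abs_mult)
  \<comment> \<open>The first product is at most \<open>8 * (t / a)\<close> and the second at most
    \<open>t / a\<close>, whence 9. With the bound \<open>6 / a\<close> on \<open>p + q\<close> this
    yields \<open>54 = 9 * 6\<close>.\<close>
  moreover have "\<bar>(1 + \<alpha>) * (a - s) - t * a\<bar> \<le> 9 * t / a"
  proof -
    have "(1 + \<alpha>) * (a - s) \<le> 2 * (a - s)" "0 \<le> (1 + \<alpha>) * (a - s)"
      using \<alpha> sa mult_right_mono[of "1 + \<alpha>" 2 "a - s"] by simp_all
    moreover have "a - s \<le> 4 * (t / a)" using as_le a by (simp add: field_simps)
    moreover have "0 \<le> t * a" "t * a \<le> t / a"
      using a a2 t0 by (auto simp: field_simps power2_eq_square)
    moreover have "\<bar>x - y\<bar> \<le> 9 * w" if "x \<le> 2 * d" "0 \<le> x" "d \<le> 4 * w" "0 \<le> y" "y \<le> w" for x y d w :: real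
      using that by linarith
    ultimately have "\<bar>(1 + \<alpha>) * (a - s) - t * a\<bar> \<le> 9 * (t / a)" by blast
    then show ?thesis by simp
  qed
  moreover have "a * a \<le> a * (a + s)" "0 < a * a" using a s by (auto intro: mult_left_mono)
  ultimately have "\<bar>p - q\<bar> \<le> (9 * t / a) / (a * a)"
    using a t0 by (simp only:) (intro frac_le; simp)
  moreover have "\<bar>p + q\<bar> \<le> 6 / a"
  proof -
    have "0 \<le> p" "p \<le> 4 / a" using \<beta> a s as by (auto simp: p_def intro!: frac_le)
    moreover have "0 \<le> q" "q \<le> 2 / a" using \<alpha> a by (auto simp: q_def intro!: divide_right_mono)
    ultimately have "\<bar>p + q\<bar> \<le> 4 / a + 2 / a" by linarith
    then show ?thesis by (simp add: field_simps)
  qed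
  ultimately have "\<bar>p - q\<bar> * \<bar>p + q\<bar> \<le> (9 * t / a) / (a * a) * (6 / a)"
    by (intro mult_mono') auto
  moreover have "p\<^sup>2 - q\<^sup>2 = (p - q) * (p + q)" by (simp add: power2_eq_square algebra_simps)
  ultimately have "\<bar>p\<^sup>2 - q\<^sup>2\<bar> \<le> (9 * t / a) / (a * a) * (6 / a)" by (simp add: abs_mult)
  also have "\<dots> = 54 / a ^ 4 * t" by (simp add: power4_eq_xxxx)
  finally show "\<bar>rho_minus \<gamma> \<alpha> l - ((1 + \<alpha>) / (1 - \<alpha>))\<^sup>2\<bar> \<le> 54 / (1 - \<alpha>) ^ 4 * (\<gamma> * l)"
    by (simp add: rho_m q_def a_def t_def)
qed

text \<open>Writing \<open>1 + \<alpha> = (w + \<gamma> * l) / 2\<close> separates the leading term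
  exactly from the correction. The correction is controlled by \<open>w \<ge> 1\<close> and by
  \<open>\<gamma> ^ 4 = \<gamma> ^ 3 / l * (\<gamma> * l)\<close> with
  \<open>\<gamma> * l \<le> 1\<close>.\<close>

lemma energy_expansion:
  fixes \<gamma> l \<alpha> :: real
  assumes "0 < \<gamma>" "0 < l" "0 \<le> \<alpha>" "\<alpha> < 1" "\<gamma> * l \<le> 1"
  shows "\<gamma>\<^sup>2 * (1 + \<alpha>) / ((1 - \<alpha>) * ((1 + \<alpha>)\<^sup>2 - (1 + \<alpha> - \<gamma> * l)\<^sup>2)) =
      \<gamma> / (2 * (1 - \<alpha>) * l) + \<gamma>\<^sup>2 / (2 * (1 - \<alpha>) * (2 * (1 + \<alpha>) - \<gamma> * l))"
    and "0 \<le> \<gamma>\<^sup>2 / (2 * (1 - \<alpha>) * (2 * (1 + \<alpha>) - \<gamma> * l))"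
    and "\<gamma>\<^sup>2 / (2 * (1 - \<alpha>) * (2 * (1 + \<alpha>) - \<gamma> * l)) \<le> 1 / (2 * (1 - \<alpha>)) * sqrt (\<gamma> ^ 3 / l)"
proof -
  define w where "w = 2 * (1 + \<alpha>) - \<gamma> * l"
  have w: "1 \<le> w" using assms by (simp add: w_def)
  have "(1 + \<alpha>)\<^sup>2 - (1 + \<alpha> - \<gamma> * l)\<^sup>2 = \<gamma> * l * w"
    by (simp add: w_def power2_eq_square algebra_simps)
  moreover have "\<gamma>\<^sup>2 * (1 + \<alpha>) / ((1 - \<alpha>) * (\<gamma> * l * w)) = \<gamma> / (2 * (1 - \<alpha>) * l) + \<gamma>\<^sup>2 / (2 * (1 - \<alpha>) * w)"
  proof -
    have "1 + \<alpha> = (w + \<gamma> * l) / 2" by (simp add: w_def)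
    then have "\<gamma>\<^sup>2 * (1 + \<alpha>) / ((1 - \<alpha>) * (\<gamma> * l * w)) = \<gamma>\<^sup>2 * ((w + \<gamma> * l) / 2) / ((1 - \<alpha>) * (\<gamma> * l * w))"
      by (rule arg_cong)
    also have "\<dots> = \<gamma> / (2 * (1 - \<alpha>) * l) + \<gamma>\<^sup>2 / (2 * (1 - \<alpha>) * w)"
    proof -
      define a where "a = 1 - \<alpha>"
      have "a \<noteq> 0" "w \<noteq> 0" "\<gamma> \<noteq> 0" "l \<noteq> 0" using assms w by (auto simp: a_def)
      then show ?thesis unfolding a_def[symmetric]
        by (simp add: field_simps power2_eq_square)
    qed
    finally show ?thesis .
  qed
  ultimately show "\<gamma>\<^sup>2 * (1 + \<alpha>) / ((1 - \<alpha>) * ((1 + \<alpha>)\<^sup>2 - (1 + \<alpha> - \<gamma> * l)\<^sup>2)) =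
      \<gamma> / (2 * (1 - \<alpha>) * l) + \<gamma>\<^sup>2 / (2 * (1 - \<alpha>) * (2 * (1 + \<alpha>) - \<gamma> * l))"
    by (simp add: w_def)
  show "0 \<le> \<gamma>\<^sup>2 / (2 * (1 - \<alpha>) * (2 * (1 + \<alpha>) - \<gamma> * l))"
    using assms w by (simp flip: w_def)
  have "\<gamma>\<^sup>2 \<le> sqrt (\<gamma> ^ 3 / l)"
  proof (rule real_le_rsqrt)
    have "(\<gamma>\<^sup>2)\<^sup>2 = \<gamma> ^ 3 / l * (\<gamma> * l)"
      using assms by (simp add: power2_eq_square power3_eq_cube)
    also have "\<dots> \<le> \<gamma> ^ 3 / l * 1"
      using assms by (intro mult_left_mono) auto
    finally show "(\<gamma>\<^sup>2)\<^sup>2 \<le> \<gamma> ^ 3 / l" by simp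
  qed
  moreover have "\<gamma>\<^sup>2 / (2 * (1 - \<alpha>) * w) \<le> \<gamma>\<^sup>2 / (2 * (1 - \<alpha>))"
    using assms w by (intro divide_left_mono) auto
  moreover have "\<gamma>\<^sup>2 / (2 * (1 - \<alpha>)) \<le> sqrt (\<gamma> ^ 3 / l) / (2 * (1 - \<alpha>))"
    if "\<gamma>\<^sup>2 \<le> sqrt (\<gamma> ^ 3 / l)"
    using that assms by (intro divide_right_mono) auto
  ultimately show "\<gamma>\<^sup>2 / (2 * (1 - \<alpha>) * (2 * (1 + \<alpha>) - \<gamma> * l)) \<le> 1 / (2 * (1 - \<alpha>)) * sqrt (\<gamma> ^ 3 / l)"
    by (simp add: w_def)
qed

text \<open>The asymptotic statements are read for fixed \<open>\<alpha>\<close>: the threshold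
  \<open>c\<close> and the constant \<open>C\<close> are chosen before all other data, and
  \<open>K\<close> sees the data only through the noise covariance, since the error of each mode
  carries the factor \<open>u i \<bullet> (noise_cov n A b *v u i)\<close>.\<close>

theorem lemma7:
  fixes \<alpha> :: real
  assumes "0 \<le> \<alpha>" and "\<alpha> < 1"
  shows "\<exists>c>0. \<exists>C :: real. \<exists>K :: real^'d^'d \<Rightarrow> real.
    \<forall>(\<gamma> :: real) (n :: nat) (A :: nat \<Rightarrow> real^'d^'d) (b :: nat \<Rightarrow> real^'d)
      (u :: 'd \<Rightarrow> real^'d) (lam :: 'd \<Rightarrow> real) (M :: 'w measure) (I :: int \<Rightarrow> 'w \<Rightarrow> nat).
      0 < \<gamma> \<longrightarrow> 1 \<le> n \<longrightarrow>
      (\<forall>i\<in>{1..n}. transpose (A i) = A i) \<longrightarrow>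
      pos_definite (average n A) \<longrightarrow>
      orthonormal_eigenbasis (average n A) u lam \<longrightarrow>
      iid_uniform_indices n M I \<longrightarrow>
      (\<forall>i. \<gamma> * lam i \<le> c * (1 - \<alpha>)) \<longrightarrow>
        (\<forall>i. \<bar>rho_plus \<gamma> \<alpha> (lam i) - 4 * (1 - \<alpha>)^2 / (\<gamma>^2 * (lam i)^2)\<bar> \<le> C * (1 / (\<gamma> * lam i))) \<and>
        (\<forall>i. \<bar>rho_minus \<gamma> \<alpha> (lam i) - ((1 + \<alpha>) / (1 - \<alpha>))^2\<bar> \<le> C * (\<gamma> * lam i)) \<and>
        (\<forall>k. \<exists>E :: 'd \<Rightarrow> real.
           (\<forall>i. \<bar>E i\<bar> \<le> K (noise_cov n A b) * sqrt (\<gamma>^3 / lam i)) \<and>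
           trace (var_matrix M (sgdm_iterate \<gamma> \<alpha> n A b I k)) =
             (\<Sum>i\<in>UNIV. \<gamma> * (u i \<bullet> (noise_cov n A b *v u i)) / (2 * (1 - \<alpha>) * lam i) + E i))"
proof -
  \<comment> \<open>The operator norm bounds the quadratic form at every unit vector, so
    \<open>K\<close> is independent of the eigenbasis; the denominator comes from
    \<open>energy_expansion\<close>.\<close>
  define K where "K S = onorm ((*v) S) / (2 * (1 - \<alpha>))" for S :: "real^'d^'d"
  have main: "(\<forall>i. \<bar>rho_plus \<gamma> \<alpha> (lam i) - 4 * (1 - \<alpha>)^2 / (\<gamma>^2 * (lam i)^2)\<bar> \<le> 54 / (1 - \<alpha>) ^ 4 * (1 / (\<gamma> * lam i))) \<and>
      (\<forall>i. \<bar>rho_minus \<gamma> \<alpha> (lam i) - ((1 + \<alpha>) / (1 - \<alpha>))^2\<bar> \<le> 54 / (1 - \<alpha>) ^ 4 * (\<gamma> * lam i)) \<and>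
      (\<forall>k. \<exists>E :: 'd \<Rightarrow> real.
         (\<forall>i. \<bar>E i\<bar> \<le> K (noise_cov n A b) * sqrt (\<gamma>^3 / lam i)) \<and>
         trace (var_matrix M (sgdm_iterate \<gamma> \<alpha> n A b I k)) =
           (\<Sum>i\<in>UNIV. \<gamma> * (u i \<bullet> (noise_cov n A b *v u i)) / (2 * (1 - \<alpha>) * lam i) + E i))"
    if \<gamma>: "0 < \<gamma>" and pd: "pos_definite (average n A)"
      and eig: "orthonormal_eigenbasis (average n A) u lam"
      and iid: "iid_uniform_indices n M I"
      and small: "\<forall>i. \<gamma> * lam i \<le> (1 - \<alpha>) / 8 * (1 - \<alpha>)"
    for \<gamma> n and A :: "nat \<Rightarrow> real^'d^'d" and b u lam and M :: "'w measure" and I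
  proof -
    have u: "orthonormal_family u" and A: "\<And>i. average n A *v u i = lam i *\<^sub>R u i"
      using eig by (auto simp: orthonormal_eigenbasis_def orthonormal_family_def)
    have uu: "u i \<bullet> u i = 1" for i using u by (simp add: orthonormal_family_def)
    have lam: "lam i > 0" for i
    proof -
      have "u i \<noteq> 0" using uu[of i] by auto
      then have "0 < u i \<bullet> (average n A *v u i)" using pd by (simp add: pos_definite_def)
      then show ?thesis by (simp add: A uu)
    qed
    have t: "0 < \<gamma> * lam i" "\<gamma> * lam i \<le> (1 - \<alpha>)\<^sup>2 / 8" "\<gamma> * lam i \<le> 1" for i
    proof -
      show "0 < \<gamma> * lam i" using \<gamma> lam by simp
      show "\<gamma> * lam i \<le> (1 - \<alpha>)\<^sup>2 / 8" using small by (simp add: power2_eq_square)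
      moreover have "(1 - \<alpha>)\<^sup>2 \<le> 1" using assms by (intro power_le_one) auto
      ultimately show "\<gamma> * lam i \<le> 1" by linarith
    qed
    have "\<exists>r s. \<bar>r\<bar> < 1 \<and> \<bar>s\<bar> < 1 \<and> r \<noteq> s \<and> r + s = 1 + \<alpha> - \<gamma> * lam i \<and> r * s = \<alpha>" for i
      using characteristic_roots[OF assms t(1,2)[of i]] by blast
    then obtain r s where r: "\<And>i. \<bar>r i\<bar> < 1" and s: "\<And>i. \<bar>s i\<bar> < 1" and rs: "\<And>i. r i \<noteq> s i"
      and vieta: "\<And>i. r i + s i = 1 + \<alpha> - \<gamma> * lam i" "\<And>i. r i * s i = \<alpha>"
      by metis
    define v where "v i = u i \<bullet> (noise_cov n A b *v u i)" for i
    define e where "e i = \<gamma>\<^sup>2 / (2 * (1 - \<alpha>) * (2 * (1 + \<alpha>) - \<gamma> * lam i))" for i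
    \<comment> \<open>Vieta's relations remove the roots from the energy, leaving
      \<open>\<alpha>\<close> and \<open>\<gamma> * lam i\<close>.\<close>
    have energy: "(\<lambda>m. (mode_response \<gamma> (r i) (s i) m)\<^sup>2) sums (\<gamma> / (2 * (1 - \<alpha>) * lam i) + e i)" for i
      using mode_response_energy[OF r s rs, of \<gamma> i] energy_expansion(1)[OF \<gamma> lam assms t(3), of i]
      by (simp add: vieta e_def)
    have trace: "trace (var_matrix M (sgdm_iterate \<gamma> \<alpha> n A b I k)) =
        (\<Sum>i\<in>UNIV. v i * (\<gamma> / (2 * (1 - \<alpha>) * lam i) + e i))" for k
      unfolding v_def
      by (rule trace_var_sgdm[OF u A lam iid sgdm_impulse_response_spectral[OF u A r s rs vieta]
            summable_mode_response[OF r s] energy])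
    have "\<bar>v i * e i\<bar> \<le> K (noise_cov n A b) * sqrt (\<gamma>^3 / lam i)" for i
    proof -
      have norm: "norm (u i) = 1" by (simp add: norm_eq_sqrt_inner uu)
      have "\<bar>v i\<bar> \<le> norm (u i) * norm (noise_cov n A b *v u i)"
        unfolding v_def by (rule Cauchy_Schwarz_ineq2)
      also have "\<dots> \<le> onorm ((*v) (noise_cov n A b))"
        using onorm[OF matrix_vector_mul_bounded_linear, of "noise_cov n A b" "u i"] by (simp add: norm)
      finally have v: "\<bar>v i\<bar> \<le> onorm ((*v) (noise_cov n A b))" .
      note e = energy_expansion(2,3)[OF \<gamma> lam assms t(3), of i, folded e_def]
      have "\<bar>v i\<bar> * e i \<le> onorm ((*v) (noise_cov n A b)) * (1 / (2 * (1 - \<alpha>)) * sqrt (\<gamma>^3 / lam i))"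
        using v e by (intro mult_mono') auto
      then show ?thesis using e(1) by (simp add: abs_mult K_def)
    qed
    then show ?thesis
      using rho_expansion[OF assms t(1,2)] trace
      by (intro conjI allI exI[of _ "\<lambda>i. v i * e i"]) (auto simp: v_def algebra_simps)
  qed
  \<comment> \<open>With this value as \<open>c\<close>, the smallness assumption reads
    \<open>\<gamma> * lam i \<le> (1 - \<alpha>)\<^sup>2 / 8\<close>, as the root and
    \<open>rho\<close> estimates require.\<close>
  have "0 < (1 - \<alpha>) / 8" using assms by simp
  with main show ?thesis by blast
qed

end
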